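(* Let $Q\ge 1$. There exists a constant $\alpha_0>0$, depending only on $Q$, such that for every $\alpha$ with $0<\alpha<\alpha_0$ there is a constant $C=C(\alpha)$, not depending on $w$, such that every weight $w\in A_2$ on $[0,1]$ with $[w]_2=Q$ satisfies $$\langle w^{1+\alpha}\rangle\le C\,\langle w\rangle^{1+\alpha}.$$
   Context: Weights are nonnegative measurable functions on $[0,1]$. For an interval $J\subset[0,1]$, $\langle\varphi\rangle_J=\frac1{|J|}\int_J\varphi(t)\,dt$, and $\langle\varphi\rangle=\langle\varphi\rangle_{[0,1]}$. For a weight $w$ on $[0,1]$ with $w$ and $w^{-1}$ integrable, $[w]_2=\sup_{J}\langle w\rangle_J\langle w^{-1}\rangle_J$, the supremum over all intervals $J\subset[0,1]$; $w\in A_2$ means $[w]_2<\infty$. *)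

theory Defs
  imports "HOL-Analysis.Analysis"
begin

text \<open>
  Averages take values in \<open>[0,\<infinity>]\<close>, so they are meaningful for every nonnegative
  measurable function, integrable or not. Only sets \<open>J\<close> of positive finite measure matter.
\<close>

definition avg :: "real set \<Rightarrow> (real \<Rightarrow> ennreal) \<Rightarrow> ennreal" where
  "avg J \<phi> = (\<integral>\<^sup>+t\<in>J. \<phi> t \<partial>lebesgue) / emeasure lebesgue J"

text \<open>Only the values of a weight on \<open>[0,1]\<close> are relevant.\<close>

definition weight :: "(real \<Rightarrow> real) \<Rightarrow> bool" where
  "weight w \<longleftrightarrow> w \<in> borel_measurable (lebesgue_on {0..1}) \<and> (\<forall>t\<in>{0..1}. 0 \<le> w t)"

text \<open>
  The reciprocal of a weight is formed in \<^typ>\<open>ennreal\<close>, where the inverse of \<open>0\<close> is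
  \<open>\<infinity>\<close>; in \<^typ>\<open>real\<close> it would be \<open>0\<close>, and weights vanishing on a set of positive
  measure could have an integrable reciprocal.
\<close>

definition recip :: "(real \<Rightarrow> real) \<Rightarrow> real \<Rightarrow> ennreal" where
  "recip w t = inverse (ennreal (w t))"

text \<open>
  The supremum runs over all nondegenerate intervals contained in \<open>[0,1]\<close>, whether open, closed
  or half-open. Positive measure rules out the empty set and single points.
\<close>

definition A2_char :: "(real \<Rightarrow> real) \<Rightarrow> ennreal" where
  "A2_char w =
    (SUP J \<in> {J. is_interval J \<and> J \<subseteq> {0..1} \<and> emeasure lebesgue J > 0}.
       avg J (\<lambda>t. ennreal (w t)) * avg J (recip w))"

definition A2 :: "(real \<Rightarrow> real) set" where
  "A2 = {w. weight w
          \<and> (\<integral>\<^sup>+t\<in>{0..1}. ennreal (w t) \<partial>lebesgue) < \<infinity>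
          \<and> (\<integral>\<^sup>+t\<in>{0..1}. recip w t \<partial>lebesgue) < \<infinity>
          \<and> A2_char w < \<infinity>}"

end

theory Submission
  imports Defs
begin

text \<open>
  The proof is a Bellman function argument, with \<open>\<alpha>\<^sub>0 = 1 / (24 Q\<^sup>2)\<close> and \<open>C = 2\<close>. For an
  interval \<open>J\<close> let \<open>x\<close> and \<open>y\<close> be the means of \<open>w\<close> and \<open>1/w\<close> over \<open>J\<close>. Then \<open>1 \<le> x y\<close> by
  Cauchy--Schwarz and \<open>x y \<le> Q\<close> by the \<open>A\<^sub>2\<close> condition. When \<open>J\<close> is bisected, \<open>(x, y)\<close> is the
  midpoint of the two points belonging to the halves. So a function \<open>B\<close> that satisfies the midpoint
  concavity inequality for such triples of points, with \<open>x\<^sup>1\<^sup>+\<^sup>\<alpha> \<le> B(x, y) \<le> 2 x\<^sup>1\<^sup>+\<^sup>\<alpha>\<close>,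
  bounds the mean of the power \<open>1 + \<alpha>\<close> of every dyadic step function of \<open>w\<close>, uniformly in the
  number of bisections (\<open>nn_integral_dyadic_mean_le_bellman\<close>).

  Such a function is \<open>B(x, y) = 2 x\<^sup>1\<^sup>+\<^sup>\<alpha> - x\<^sup>\<alpha>\<^sup>-\<^sup>1 y\<^sup>-\<^sup>2\<close>. For \<open>\<alpha> = 0\<close> it is linear in \<open>x\<close>
  minus \<open>1 / (x y\<^sup>2)\<close>, and the latter is strictly convex on the whole positive quadrant. A small
  \<open>\<alpha> > 0\<close> adds a convexity of order \<open>\<alpha>\<close>, which the strict convexity of the subtracted term
  compensates as long as \<open>\<alpha> (x y)\<^sup>2\<close> is small (\<open>hessian_form_nonpos\<close>). A segment whose endpoints and
  midpoint lie in \<open>x y \<le> Q\<close> stays in \<open>x y \<le> 2 Q\<close> (\<open>product_le_on_segment\<close>), so for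
  \<open>\<alpha> < \<alpha>\<^sub>0\<close> the function is concave along it (\<open>bellman_midpoint\<close>).

  The dyadic step functions converge to \<open>w\<close> in \<open>L\<^sup>1\<close>, because continuous functions are dense there,
  hence almost everywhere along a subsequence (\<open>dyadic_mean_subseq_tendsto_AE\<close>), and Fatou's lemma
  carries the uniform bound over to \<open>w\<close> (\<open>reverse_holder_of_positive\<close>).
\<close>

section \<open>A Bellman function\<close>

text \<open>
  For positive \<open>x\<close> and \<open>y\<close> this is \<open>x\<^sup>1\<^sup>+\<^sup>\<alpha> (2 - (x y)\<^sup>-\<^sup>2)\<close>; where \<open>x y \<ge> 1\<close> it lies between
  \<open>x\<^sup>1\<^sup>+\<^sup>\<alpha>\<close> and \<open>2 x\<^sup>1\<^sup>+\<^sup>\<alpha>\<close>.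
\<close>
definition bellman :: "real \<Rightarrow> real \<Rightarrow> real \<Rightarrow> real" where
  "bellman \<alpha> x y = 2 * x powr (1 + \<alpha>) - x powr (\<alpha> - 1) * y powr (-2)"

text \<open>
  Up to a positive factor this is the second derivative of \<^term>\<open>bellman \<alpha>\<close> along a line, with
  \<open>s = x y\<close>, \<open>U = y dx\<close> and \<open>V = x dy\<close>. Completing the square in \<open>V\<close> leaves a
  multiple of \<open>U\<^sup>2\<close> in which the convex contribution \<open>2 \<alpha> (1 + \<alpha>) s\<^sup>2\<close> of
  \<open>x\<^sup>1\<^sup>+\<^sup>\<alpha>\<close> has to be absorbed by a positive constant; here the size of \<open>\<alpha>\<close> is decided.
\<close>
lemma hessian_form_nonpos:
  fixes \<alpha> s U V Q :: real
  assumes "0 < \<alpha>" "24 * \<alpha> * Q\<^sup>2 \<le> 1" "Q \<ge> 1" "0 < s" "s \<le> 2 * Q"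
  shows "2 * \<alpha> * (1 + \<alpha>) * s\<^sup>2 * U\<^sup>2 - (1 - \<alpha>) * (2 - \<alpha>) * U\<^sup>2
           - 4 * (1 - \<alpha>) * (U * V) - 6 * V\<^sup>2 \<le> 0"
proof -
  have Q1: "1 \<le> Q\<^sup>2" using assms by simp
  have "24 * \<alpha> \<le> 24 * \<alpha> * Q\<^sup>2" using Q1 assms by simp
  then have a: "\<alpha> \<le> 1/24" using assms by linarith
  have s2: "s\<^sup>2 \<le> 4 * Q\<^sup>2" using power_mono[of s "2*Q" 2] assms by (simp add: power_mult_distrib)
  have as: "\<alpha> * s\<^sup>2 \<le> 1/6"
    using mult_left_mono[OF s2, of \<alpha>] assms by linarith
  have 1: "2 * \<alpha> * (1 + \<alpha>) * s\<^sup>2 \<le> 1/2"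
  proof -
    have "2 * \<alpha> * (1 + \<alpha>) * s\<^sup>2 = 2 * (1 + \<alpha>) * (\<alpha> * s\<^sup>2)" by (simp add: algebra_simps)
    also have "\<dots> \<le> 2 * (1 + 1/24) * (1/6)"
      using a as assms by (intro mult_mono) auto
    finally show ?thesis by simp
  qed
  have 2: "(1 - \<alpha>) * (2 - \<alpha>) - 2/3 * (1 - \<alpha>)\<^sup>2 \<ge> 1/2"
  proof -
    have "(1 - \<alpha>) * (2 - \<alpha>) - 2/3 * (1 - \<alpha>)\<^sup>2 = (1 - \<alpha>) * (4/3 - \<alpha>/3)"
      by (simp add: field_simps power2_eq_square)
    moreover have "(1 - 1/24) * (4/3 - 1/72) \<le> (1 - \<alpha>) * (4/3 - \<alpha>/3)"
      using a assms by (intro mult_mono) auto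
    ultimately show ?thesis by simp
  qed
  have "2 * \<alpha> * (1 + \<alpha>) * s\<^sup>2 * U\<^sup>2 - (1 - \<alpha>) * (2 - \<alpha>) * U\<^sup>2
           - 4 * (1 - \<alpha>) * (U * V) - 6 * V\<^sup>2
      = (2 * \<alpha> * (1 + \<alpha>) * s\<^sup>2 - ((1 - \<alpha>) * (2 - \<alpha>) - 2/3 * (1 - \<alpha>)\<^sup>2)) * U\<^sup>2
        - 6 * (V + (1 - \<alpha>) / 3 * U)\<^sup>2"
    by (simp add: field_simps power2_eq_square)
  also have "\<dots> \<le> 0"
  proof -
    have "(2 * \<alpha> * (1 + \<alpha>) * s\<^sup>2 - ((1 - \<alpha>) * (2 - \<alpha>) - 2/3 * (1 - \<alpha>)\<^sup>2)) * U\<^sup>2 \<le> 0"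
      using 1 2 by (intro mult_nonpos_nonneg) (linarith, simp)
    moreover have "0 \<le> 6 * (V + (1 - \<alpha>) / 3 * U)\<^sup>2" by simp
    ultimately show ?thesis by linarith
  qed
  finally show ?thesis .
qed

text \<open>
  The region \<open>x y \<le> Q\<close> is not convex, so a segment may leave it even if its endpoints and its
  midpoint do not. It cannot go far: along the segment \<open>x y\<close> is a quadratic polynomial, determined
  by its values at \<open>0\<close>, \<open>1/2\<close> and \<open>1\<close>, and of the three Lagrange weights at \<open>t\<close> one is
  nonpositive and the other two add up to at most \<open>2\<close>.
\<close>
lemma product_le_on_segment:
  fixes x1 x2 y1 y2 Q t :: real
  assumes "0 < x1" "0 < x2" "0 < y1" "0 < y2" "x1 * y1 \<le> Q" "x2 * y2 \<le> Q"
    and "(x1 + x2) / 2 * ((y1 + y2) / 2) \<le> Q" "0 \<le> t" "t \<le> 1"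
  shows "(x1 + t * (x2 - x1)) * (y1 + t * (y2 - y1)) \<le> 2 * Q"
proof -
  have Q0: "0 < Q" using assms by (meson less_le_trans mult_pos_pos)
  let ?m = "(x1 + x2) / 2 * ((y1 + y2) / 2)"
  have eq: "(x1 + t * (x2 - x1)) * (y1 + t * (y2 - y1))
    = ((1 - t) * (1 - 2 * t)) * (x1 * y1) + 4 * t * (1 - t) * ?m + (t * (2 * t - 1)) * (x2 * y2)"
    by (simp add: field_simps)
  have b: "4 * t * (1 - t) * ?m \<le> 4 * t * (1 - t) * Q"
    using assms by (intro mult_left_mono) auto
  show ?thesis
  proof (cases "t \<le> 1/2")
    case True
    \<comment> \<open>The weight of the far endpoint is nonpositive and is dropped.\<close>
    have a: "((1 - t) * (1 - 2 * t)) * (x1 * y1) \<le> ((1 - t) * (1 - 2 * t)) * Q"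
      using assms True by (intro mult_left_mono) auto
    have c: "(t * (2 * t - 1)) * (x2 * y2) \<le> 0"
      using assms True by (intro mult_nonpos_nonneg[OF mult_nonneg_nonpos]) auto
    have "(1 - t) * (1 - 2 * t) + 4 * t * (1 - t) = 2 - (1 - t) - 2 * t\<^sup>2"
      by (simp add: algebra_simps power2_eq_square)
    also have "\<dots> \<le> 2" using assms by (smt (verit) zero_le_power2)
    finally have "((1 - t) * (1 - 2 * t) + 4 * t * (1 - t)) * Q \<le> 2 * Q"
      using Q0 by simp
    then show ?thesis unfolding eq using a b c by (simp add: distrib_right)
  next
    case False
    have a: "((1 - t) * (1 - 2 * t)) * (x1 * y1) \<le> 0"
      using assms False by (intro mult_nonpos_nonneg[OF mult_nonneg_nonpos]) auto
    have c: "(t * (2 * t - 1)) * (x2 * y2) \<le> (t * (2 * t - 1)) * Q"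
      using assms False by (intro mult_left_mono) auto
    have "4 * t * (1 - t) + t * (2 * t - 1) = 2 - t - 2 * (1 - t)\<^sup>2"
      by (simp add: algebra_simps power2_eq_square)
    also have "\<dots> \<le> 2" using assms by (smt (verit) zero_le_power2)
    finally have "(4 * t * (1 - t) + t * (2 * t - 1)) * Q \<le> 2 * Q"
      using Q0 by simp
    then show ?thesis unfolding eq using a b c by (simp add: distrib_right)
  qed
qed

text \<open>
  The whole segment stays in \<open>x y \<le> 2 Q\<close>, where the Hessian form is nonpositive in every
  direction, so the restriction of \<^term>\<open>bellman \<alpha>\<close> to the segment is concave.
\<close>
lemma bellman_midpoint:
  assumes \<alpha>: "0 < \<alpha>" "24 * \<alpha> * Q\<^sup>2 \<le> 1" "Q \<ge> 1"
    and pos: "0 < x1" "0 < x2" "0 < y1" "0 < y2"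
    and le: "x1 * y1 \<le> Q" "x2 * y2 \<le> Q" "(x1 + x2) / 2 * ((y1 + y2) / 2) \<le> Q"
  shows "(bellman \<alpha> x1 y1 + bellman \<alpha> x2 y2) / 2 \<le> bellman \<alpha> ((x1 + x2) / 2) ((y1 + y2) / 2)"
proof -
  define p q where "p = x2 - x1" and "q = y2 - y1"
  define x y where "x t = x1 + t * p" and "y t = y1 + t * q" for t
  define \<phi> where "\<phi> t = bellman \<alpha> (x t) (y t)" for t
  define \<phi>' where "\<phi>' t = 2 * (1 + \<alpha>) * p * x t powr \<alpha>
      - (\<alpha> - 1) * p * (x t powr (\<alpha> - 2) * y t powr (-2))
      + 2 * q * (x t powr (\<alpha> - 1) * y t powr (-3))" for t
  define \<phi>'' where "\<phi>'' t = 2 * (1 + \<alpha>) * \<alpha> * p\<^sup>2 * x t powr (\<alpha> - 1)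
      - (\<alpha> - 1) * (\<alpha> - 2) * p\<^sup>2 * (x t powr (\<alpha> - 3) * y t powr (-2))
      + 4 * (\<alpha> - 1) * (p * q) * (x t powr (\<alpha> - 2) * y t powr (-3))
      - 6 * q\<^sup>2 * (x t powr (\<alpha> - 1) * y t powr (-4))" for t
  have seg: "0 < u + t * (v - u)" if "0 < u" "0 < v" "t \<in> {0..1}" for u v t :: real
  proof -
    have "u + t * (v - u) = (1 - t) * u + t * v" by (simp add: algebra_simps)
    moreover have "\<dots> > 0"
      using that by (cases "t = 1") (auto intro!: add_pos_nonneg)
    ultimately show ?thesis by simp
  qed
  have xp: "x t > 0" and yp: "y t > 0" if "t \<in> {0..1}" for t
    unfolding x_def y_def p_def q_def using seg pos that by auto
  have dx: "(x has_real_derivative p) (at t)" and dy: "(y has_real_derivative q) (at t)" for t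
    unfolding x_def y_def by (auto intro!: derivative_eq_intros)
  have dxr: "((\<lambda>t. x t powr r) has_real_derivative r * x t powr (r - 1) * p) (at t)"
    if "t \<in> {0..1}" for t r using DERIV_fun_powr[OF dx xp[OF that]] by simp
  have dyr: "((\<lambda>t. y t powr r) has_real_derivative r * y t powr (r - 1) * q) (at t)"
    if "t \<in> {0..1}" for t r using DERIV_fun_powr[OF dy yp[OF that]] by simp
  have "concave_on {0..1} \<phi>"
  proof (rule f''_le0_imp_concave)
    show "convex {0..1::real}" by simp
    fix t :: real assume t: "t \<in> {0..1}"
    show "(\<phi> has_real_derivative \<phi>' t) (at t)"
      unfolding \<phi>_def bellman_def
      by (rule DERIV_cong[OF DERIV_diff[OF DERIV_cmult[OF dxr[OF t]]
              DERIV_mult[OF dxr[OF t] dyr[OF t]]]])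
        (simp add: \<phi>'_def algebra_simps)
    show "(\<phi>' has_real_derivative \<phi>'' t) (at t)"
      unfolding \<phi>'_def
      by (rule DERIV_cong[OF DERIV_add[OF DERIV_diff[OF DERIV_cmult[OF dxr[OF t]]
            DERIV_cmult[OF DERIV_mult[OF dxr[OF t] dyr[OF t]]]]
              DERIV_cmult[OF DERIV_mult[OF dxr[OF t] dyr[OF t]]]]])
        (simp add: \<phi>''_def algebra_simps power2_eq_square)
    define P R where "P = x t powr (\<alpha> - 3)" and "R = y t powr (-4)"
    \<comment> \<open>Factoring out the lowest powers of both variables turns \<open>\<phi>''\<close> into the Hessian form.\<close>
    have P: "x t powr (\<alpha> - 1) = P * x t ^ 2" "x t powr (\<alpha> - 2) = P * x t"
      using xp[OF t] powr_add[of "x t" "\<alpha> - 3" 2] powr_add[of "x t" "\<alpha> - 3" 1]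
      by (auto simp: P_def powr_numeral)
    have R: "y t powr (-2) = R * y t ^ 2" "y t powr (-3) = R * y t"
      "1 = R * y t ^ 4"
      using yp[OF t] powr_add[of "y t" "-4" 2] powr_add[of "y t" "-4" 1] powr_add[of "y t" "-4" 4]
      by (auto simp: R_def powr_numeral)
    have "\<phi>'' t = 2 * (1 + \<alpha>) * \<alpha> * p\<^sup>2 * (P * x t ^ 2) * 1
      - (\<alpha> - 1) * (\<alpha> - 2) * p\<^sup>2 * (P * (R * y t ^ 2))
      + 4 * (\<alpha> - 1) * (p * q) * (P * x t * (R * y t))
      - 6 * q\<^sup>2 * (P * x t ^ 2 * R)"
      unfolding \<phi>''_def P R(1,2) P_def[symmetric] R_def[symmetric] by simp
    also have "\<dots> = P * R * (2 * \<alpha> * (1 + \<alpha>) * (x t * y t)\<^sup>2 * (p * y t)\<^sup>2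
           - (1 - \<alpha>) * (2 - \<alpha>) * (p * y t)\<^sup>2
           - 4 * (1 - \<alpha>) * ((p * y t) * (q * x t)) - 6 * (q * x t)\<^sup>2)"
      unfolding R(3) by (simp add: algebra_simps power2_eq_square power4_eq_xxxx)
    also have "\<dots> \<le> 0"
    proof (rule mult_nonneg_nonpos)
      show "0 \<le> P * R" by (simp add: P_def R_def)
      have "x t * y t \<le> 2 * Q"
        using product_le_on_segment[OF pos le, of t] t by (simp add: x_def y_def p_def q_def)
      then show "2 * \<alpha> * (1 + \<alpha>) * (x t * y t)\<^sup>2 * (p * y t)\<^sup>2
           - (1 - \<alpha>) * (2 - \<alpha>) * (p * y t)\<^sup>2
           - 4 * (1 - \<alpha>) * ((p * y t) * (q * x t)) - 6 * (q * x t)\<^sup>2 \<le> 0"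
        using \<alpha> xp[OF t] yp[OF t] by (intro hessian_form_nonpos) auto
    qed
    finally show "\<phi>'' t \<le> 0" .
  qed
  from concave_onD[OF this, of "1/2" 0 1]
  have "\<phi> (1/2) \<ge> (\<phi> 0 + \<phi> 1) / 2" by simp
  moreover have "\<phi> 0 = bellman \<alpha> x1 y1" "\<phi> 1 = bellman \<alpha> x2 y2"
    "\<phi> (1/2) = bellman \<alpha> ((x1 + x2) / 2) ((y1 + y2) / 2)"
    by (simp_all add: \<phi>_def x_def y_def p_def q_def field_simps)
  ultimately show ?thesis by simp
qed

lemma powr_le_bellman:
  assumes "0 < x" "0 < y" "1 \<le> x * y"
  shows "x powr (1 + \<alpha>) \<le> bellman \<alpha> x y"
proof -
  have "x powr (\<alpha> - 1) * y powr (-2) = x powr (1 + \<alpha>) * (x * y) powr (-2)"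
    using assms by (simp add: powr_mult powr_add[symmetric] mult.assoc[symmetric])
  also have "\<dots> \<le> x powr (1 + \<alpha>) * 1"
  proof (rule mult_left_mono)
    have "1 \<le> (x * y)\<^sup>2" using assms by (simp add: one_le_power)
    then show "(x * y) powr (-2) \<le> 1"
      using assms by (simp add: powr_minus powr_numeral divide_simps)
  qed simp
  finally show ?thesis by (simp add: bellman_def)
qed

section \<open>Means over an interval and its bisections\<close>

definition mean :: "(real \<Rightarrow> real) \<Rightarrow> real \<Rightarrow> real \<Rightarrow> real" where
  "mean f a b = integral {a..b} f / (b - a)"

text \<open>
  The step function on \<open>[a,b]\<close> whose value on each of the \<open>2\<^sup>n\<close> pieces of equal length is the mean
  of \<open>f\<close> there. Recursion on the two halves makes every estimate below an induction over all
  intervals at once, in which only a single bisection has to be examined.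
\<close>
fun dyadic_mean :: "nat \<Rightarrow> (real \<Rightarrow> real) \<Rightarrow> real \<Rightarrow> real \<Rightarrow> real \<Rightarrow> real" where
  "dyadic_mean 0 f a b t = mean f a b"
| "dyadic_mean (Suc n) f a b t =
     (if t < (a + b) / 2 then dyadic_mean n f a ((a + b) / 2) t
      else dyadic_mean n f ((a + b) / 2) b t)"

lemma mean_midpoint:
  assumes "f integrable_on {a..b}" "a < b"
  shows "mean f a b = (mean f a ((a + b) / 2) + mean f ((a + b) / 2) b) / 2"
proof -
  have "integral {a..b} f = integral {a..(a + b) / 2} f + integral {(a + b) / 2..b} f"
    using assms by (intro Henstock_Kurzweil_Integration.integral_combine[symmetric]) auto
  moreover have "(a + b) / 2 - a = (b - a) / 2" "b - (a + b) / 2 = (b - a) / 2"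
    by (simp_all add: field_simps)
  ultimately show ?thesis
    unfolding mean_def by (simp add: add_divide_distrib)
qed

text \<open>
  This is the Cauchy--Schwarz inequality; it follows by integrating
  \<open>2 \<le> k f + 1 / (k f)\<close> and taking \<open>k\<close> to be the reciprocal of the mean of \<open>f\<close>.
\<close>
lemma mean_mult_mean_inverse_ge_1:
  assumes "a < b" and f: "f integrable_on {a..b}" and g: "(\<lambda>t. inverse (f t)) integrable_on {a..b}"
    and pos: "\<And>t. t \<in> {a..b} \<Longrightarrow> 0 < f t"
  shows "0 < mean f a b" "0 < mean (\<lambda>t. inverse (f t)) a b"
    "1 \<le> mean f a b * mean (\<lambda>t. inverse (f t)) a b"
proof -
  define X Y where "X = mean f a b" and "Y = mean (\<lambda>t. inverse (f t)) a b"
  have X0: "0 \<le> X" and Y0: "0 \<le> Y"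
    using assms unfolding X_def Y_def mean_def
    by (auto intro!: divide_nonneg_nonneg integral_nonneg simp: less_imp_le)
  have *: "2 \<le> k * X + Y / k" if "k > 0" for k
  proof -
    have amgm: "2 \<le> k * f t + inverse (f t) / k" if "t \<in> {a..b}" for t
    proof -
      have p: "0 < f t" using pos that by auto
      have "0 \<le> (k * f t - 1)\<^sup>2" by simp
      then have "2 * (k * f t) \<le> (k * f t) * (k * f t) + 1"
        by (simp add: power2_eq_square algebra_simps)
      then show ?thesis using p \<open>k > 0\<close> by (simp add: field_simps)
    qed
    have "integral {a..b} (\<lambda>t. 2::real) \<le> integral {a..b} (\<lambda>t. k * f t + inverse (f t) / k)"
      using amgm f g by (intro integral_le integrable_add integrable_on_mult_right integrable_on_divide) auto
    also have "\<dots> = k * integral {a..b} f + integral {a..b} (\<lambda>t. inverse (f t)) / k"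
      using f g by (simp add: integral_add integrable_on_mult_right integrable_on_divide)
    finally have "2 * (b - a) \<le> k * integral {a..b} f + integral {a..b} (\<lambda>t. inverse (f t)) / k"
      using \<open>a < b\<close> by simp
    moreover have "integral {a..b} f = X * (b - a)"
      "integral {a..b} (\<lambda>t. inverse (f t)) = Y * (b - a)"
      using \<open>a < b\<close> by (simp_all add: X_def Y_def mean_def)
    ultimately have "2 * (b - a) \<le> (k * X + Y / k) * (b - a)"
      by (simp only: distrib_right times_divide_eq_left mult.assoc)
    then show ?thesis using \<open>a < b\<close> by (meson diff_gt_0_iff_gt mult_right_le_imp_le)
  qed
  \<comment> \<open>If \<open>X\<close> vanished, letting \<open>k\<close> grow would bring the right-hand side of \<open>*\<close> below \<open>2\<close>.\<close>
  have "X \<noteq> 0"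
  proof
    assume "X = 0"
    then have "2 \<le> Y / (Y + 1)" using *[of "Y + 1"] Y0 by simp
    then show False using Y0 by (simp add: field_simps)
  qed
  then have Xp: "0 < X" using X0 by simp
  have XY: "1 \<le> X * Y" using *[of "1 / X"] Xp by (simp add: mult.commute)
  with Xp Y0 have "0 < Y" by (cases "Y = 0") auto
  then show "0 < mean f a b" "0 < mean (\<lambda>t. inverse (f t)) a b"
    "1 \<le> mean f a b * mean (\<lambda>t. inverse (f t)) a b"
    using Xp XY unfolding X_def Y_def by auto
qed

lemma nn_integral_eq_ennreal_integral:
  fixes f :: "real \<Rightarrow> real"
  assumes "f integrable_on {a..b}" "\<And>t. t \<in> {a..b} \<Longrightarrow> 0 \<le> f t"
  shows "(\<integral>\<^sup>+t\<in>{a..b}. ennreal (f t) \<partial>lebesgue) = ennreal (integral {a..b} f)"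
proof -
  let ?F = "\<lambda>t. if t \<in> {a..b} then f t else 0"
  have "(f has_integral integral {a..b} f) {a..b}"
    using assms by (simp add: integrable_integral)
  then have "(?F has_integral integral {a..b} f) UNIV"
    by (simp only: has_integral_restrict_UNIV)
  then have "(\<integral>\<^sup>+t. ennreal (?F t) \<partial>lebesgue) = ennreal (integral {a..b} f)"
    using has_integral_iff_nn_integral_lebesgue[of ?F] assms(2) by auto
  moreover have "(\<integral>\<^sup>+t\<in>{a..b}. ennreal (f t) \<partial>lebesgue) = (\<integral>\<^sup>+t. ennreal (?F t) \<partial>lebesgue)"
    by (intro nn_integral_cong) (auto simp: indicator_def)
  ultimately show ?thesis by simp
qed

lemma nn_integral_if_less_le:
  fixes a b c :: real
  assumes [measurable]: "h1 \<in> borel_measurable lebesgue" "h2 \<in> borel_measurable lebesgue"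
  shows "(\<integral>\<^sup>+t\<in>{a..b}. (if t < c then h1 t else h2 t) \<partial>lebesgue)
    \<le> (\<integral>\<^sup>+t\<in>{a..c}. h1 t \<partial>lebesgue) + (\<integral>\<^sup>+t\<in>{c..b}. h2 t \<partial>lebesgue)"
proof -
  have [measurable]: "{a..c} \<in> sets lebesgue" "{c..b} \<in> sets lebesgue" by auto
  have "(\<integral>\<^sup>+t\<in>{a..b}. (if t < c then h1 t else h2 t) \<partial>lebesgue)
    \<le> (\<integral>\<^sup>+t. h1 t * indicator {a..c} t + h2 t * indicator {c..b} t \<partial>lebesgue)"
    by (intro nn_integral_mono) (auto simp: indicator_def)
  also have "\<dots> = (\<integral>\<^sup>+t\<in>{a..c}. h1 t \<partial>lebesgue) + (\<integral>\<^sup>+t\<in>{c..b}. h2 t \<partial>lebesgue)"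
    by (intro nn_integral_add) measurable
  finally show ?thesis .
qed

lemma borel_measurable_dyadic_mean [measurable]:
  "dyadic_mean n f a b \<in> borel_measurable lebesgue"
proof (induction n arbitrary: a b)
  case 0
  have "dyadic_mean 0 f a b = (\<lambda>t. mean f a b)" by (rule ext) simp
  then show ?case by simp
next
  case (Suc n)
  have eq: "dyadic_mean (Suc n) f a b = (\<lambda>t. if t \<in> {..<(a + b) / 2}
      then dyadic_mean n f a ((a + b) / 2) t else dyadic_mean n f ((a + b) / 2) b t)"
    by (rule ext) simp
  show ?case unfolding eq
    using Suc by (intro measurable_If_set) auto
qed

section \<open>The Bellman induction\<close>

text \<open>
  Bisecting an interval replaces the pair of means of \<open>f\<close> and \<open>1/f\<close> by two pairs with that pair as
  midpoint. By midpoint concavity the total of \<^term>\<open>bellman \<alpha>\<close> over the pieces, weighted by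
  length, does not increase under bisection, and at the last stage it dominates the integral of the power.
\<close>
lemma nn_integral_dyadic_mean_le_bellman:
  assumes \<alpha>: "0 < \<alpha>" "24 * \<alpha> * Q\<^sup>2 \<le> 1" "Q \<ge> 1"
    and "a < b" "f integrable_on {a..b}" "(\<lambda>t. inverse (f t)) integrable_on {a..b}"
    and "\<And>t. t \<in> {a..b} \<Longrightarrow> 0 < f t"
    and "\<And>c d. a \<le> c \<Longrightarrow> c < d \<Longrightarrow> d \<le> b \<Longrightarrow> mean f c d * mean (\<lambda>t. inverse (f t)) c d \<le> Q"
  shows "(\<integral>\<^sup>+t\<in>{a..b}. ennreal (dyadic_mean n f a b t powr (1 + \<alpha>)) \<partial>lebesgue)
    \<le> ennreal ((b - a) * bellman \<alpha> (mean f a b) (mean (\<lambda>t. inverse (f t)) a b))"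
  using assms(4-)
proof (induction n arbitrary: a b)
  case 0
  have "(\<integral>\<^sup>+t\<in>{a..b}. ennreal (dyadic_mean 0 f a b t powr (1 + \<alpha>)) \<partial>lebesgue)
     = ennreal (mean f a b powr (1 + \<alpha>)) * ennreal (b - a)"
    using 0 by (simp add: nn_integral_cmult_indicator)
  also have "\<dots> = ennreal ((b - a) * mean f a b powr (1 + \<alpha>))"
    using 0 by (simp add: ennreal_mult' mult.commute)
  also have "\<dots> \<le> ennreal ((b - a) * bellman \<alpha> (mean f a b) (mean (\<lambda>t. inverse (f t)) a b))"
    using 0 mean_mult_mean_inverse_ge_1[of a b f]
    by (intro ennreal_leI mult_left_mono powr_le_bellman) auto
  finally show ?case .
next
  case (Suc n)
  define c where "c = (a + b) / 2"
  let ?g = "\<lambda>t. inverse (f t)"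
  have c: "a < c" "c < b" "c - a = (b - a) / 2" "b - c = (b - a) / 2"
    using Suc.prems(1) by (auto simp: c_def field_simps)
  have int: "f integrable_on {a..c}" "f integrable_on {c..b}"
    "?g integrable_on {a..c}" "?g integrable_on {c..b}"
    using Suc.prems(2,3) c by (auto intro: integrable_subinterval_real)
  note le = Suc.prems(5)
  have IH1: "(\<integral>\<^sup>+t\<in>{a..c}. ennreal (dyadic_mean n f a c t powr (1 + \<alpha>)) \<partial>lebesgue)
      \<le> ennreal ((c - a) * bellman \<alpha> (mean f a c) (mean ?g a c))"
    using c int Suc.prems(4) by (intro Suc.IH le) auto
  have IH2: "(\<integral>\<^sup>+t\<in>{c..b}. ennreal (dyadic_mean n f c b t powr (1 + \<alpha>)) \<partial>lebesgue)
      \<le> ennreal ((b - c) * bellman \<alpha> (mean f c b) (mean ?g c b))"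
    using c int Suc.prems(4) by (intro Suc.IH le) auto
  note m1 = mean_mult_mean_inverse_ge_1[OF c(1) int(1,3)]
  note m2 = mean_mult_mean_inverse_ge_1[OF c(2) int(2,4)]
  have p: "0 < mean f a c" "0 < mean ?g a c" "1 \<le> mean f a c * mean ?g a c"
    "0 < mean f c b" "0 < mean ?g c b" "1 \<le> mean f c b * mean ?g c b"
    using m1 m2 Suc.prems(4) c by auto
  have mid: "mean f a b = (mean f a c + mean f c b) / 2" "mean ?g a b = (mean ?g a c + mean ?g c b) / 2"
    unfolding c_def using Suc.prems by (intro mean_midpoint; simp)+
  have nonneg: "0 \<le> bellman \<alpha> (mean f a c) (mean ?g a c)" "0 \<le> bellman \<alpha> (mean f c b) (mean ?g c b)"
    using p by (auto intro: order_trans[OF powr_ge_zero powr_le_bellman])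
  have conc: "(bellman \<alpha> (mean f a c) (mean ?g a c) + bellman \<alpha> (mean f c b) (mean ?g c b)) / 2
      \<le> bellman \<alpha> (mean f a b) (mean ?g a b)"
    unfolding mid using p le[of a c] le[of c b] le[of a b] c
    by (intro bellman_midpoint[OF \<alpha>]) (simp_all add: mid)
  have "(\<integral>\<^sup>+t\<in>{a..b}. ennreal (dyadic_mean (Suc n) f a b t powr (1 + \<alpha>)) \<partial>lebesgue)
    = (\<integral>\<^sup>+t\<in>{a..b}. (if t < c then ennreal (dyadic_mean n f a c t powr (1 + \<alpha>))
          else ennreal (dyadic_mean n f c b t powr (1 + \<alpha>))) \<partial>lebesgue)"
    by (intro nn_integral_cong) (simp add: c_def)
  also have "\<dots> \<le> ennreal ((c - a) * bellman \<alpha> (mean f a c) (mean ?g a c))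
      + ennreal ((b - c) * bellman \<alpha> (mean f c b) (mean ?g c b))"
    by (rule order_trans[OF nn_integral_if_less_le add_mono[OF IH1 IH2]]) measurable
  also have "\<dots> = ennreal ((b - a) * ((bellman \<alpha> (mean f a c) (mean ?g a c)
      + bellman \<alpha> (mean f c b) (mean ?g c b)) / 2))"
    unfolding c(3,4) using nonneg Suc.prems(1)
    by (subst ennreal_plus[symmetric]) (simp_all add: distrib_left add_divide_distrib del: ennreal_plus)
  also have "\<dots> \<le> ennreal ((b - a) * bellman \<alpha> (mean f a b) (mean ?g a b))"
    using conc c by (intro ennreal_leI mult_left_mono) auto
  finally show ?case .
qed

section \<open>Convergence of dyadic means\<close>

text \<open>
  Replacing \<open>f\<close> by its mean over a piece costs at most the \<open>L\<^sup>1\<close> distance from \<open>f\<close> to \<open>g\<close> twice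
  (once for the function and once for its mean) plus the oscillation of \<open>g\<close> on the piece. The
  hypothesis on \<open>g\<close> refers only to the length of the final pieces, so it passes unchanged to the halves.
\<close>
lemma nn_integral_dyadic_mean_diff_le:
  assumes "a < b" "f absolutely_integrable_on {a..b}" "g integrable_on {a..b}"
    "(\<lambda>t. \<bar>f t - g t\<bar>) integrable_on {a..b}"
    and f[measurable]: "f \<in> borel_measurable lebesgue"
    and "\<And>s t. s \<in> {a..b} \<Longrightarrow> t \<in> {a..b} \<Longrightarrow> \<bar>s - t\<bar> \<le> (b - a) / 2 ^ n \<Longrightarrow> \<bar>g s - g t\<bar> \<le> \<epsilon>"
  shows "(\<integral>\<^sup>+t\<in>{a..b}. ennreal \<bar>dyadic_mean n f a b t - f t\<bar> \<partial>lebesgue)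
    \<le> ennreal (2 * integral {a..b} (\<lambda>t. \<bar>f t - g t\<bar>) + \<epsilon> * (b - a))"
  using assms(1-4,6)
proof (induction n arbitrary: a b)
  case 0
  define I where "I = integral {a..b} (\<lambda>t. \<bar>f t - g t\<bar>)"
  have fi: "f integrable_on {a..b}" using 0 by (simp add: set_lebesgue_integral_eq_integral)
  note dint = 0(4)
  have I0: "0 \<le> I" unfolding I_def using dint by (intro integral_nonneg) auto
  have m: "\<bar>mean f a b - f t\<bar> \<le> \<bar>f t - g t\<bar> + (I / (b - a) + \<epsilon>)" if t: "t \<in> {a..b}" for t
  proof -
    have "\<bar>integral {a..b} (\<lambda>s. f s - g t)\<bar> \<le> integral {a..b} (\<lambda>s. \<bar>f s - g s\<bar> + \<epsilon>)"
      unfolding real_norm_def[symmetric]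
    proof (rule integral_norm_bound_integral)
      show "(\<lambda>s. f s - g t) integrable_on {a..b}" using fi by (intro integrable_diff) auto
      show "(\<lambda>s. norm (f s - g s) + \<epsilon>) integrable_on {a..b}"
        using dint by (intro integrable_add) auto
      fix s assume s: "s \<in> {a..b}"
      then have "\<bar>g s - g t\<bar> \<le> \<epsilon>" using t by (intro 0(5)) auto
      then show "norm (f s - g t) \<le> norm (f s - g s) + \<epsilon>" by auto
    qed
    also have "\<dots> = I + \<epsilon> * (b - a)"
      using dint 0(1) by (subst integral_add) (auto simp: I_def)
    also have "integral {a..b} (\<lambda>s. f s - g t) = integral {a..b} f - g t * (b - a)"
      using fi 0(1) by (subst integral_diff) auto
    also have "\<dots> = (mean f a b - g t) * (b - a)"
      using 0(1) by (simp add: mean_def field_simps)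
    finally have "\<bar>mean f a b - g t\<bar> \<le> I / (b - a) + \<epsilon>"
      using 0(1) by (simp add: abs_mult pos_le_divide_eq[symmetric] add_divide_distrib)
    then show ?thesis by linarith
  qed
  have "\<epsilon> \<ge> 0" using 0(5)[of a a] 0(1) by simp
  have "(\<integral>\<^sup>+t\<in>{a..b}. ennreal \<bar>dyadic_mean 0 f a b t - f t\<bar> \<partial>lebesgue)
    \<le> (\<integral>\<^sup>+t\<in>{a..b}. ennreal (\<bar>f t - g t\<bar> + (I / (b - a) + \<epsilon>)) \<partial>lebesgue)"
    using m by (intro nn_integral_mono) (auto simp: indicator_def intro!: ennreal_leI)
  also have "\<dots> = ennreal (integral {a..b} (\<lambda>t. \<bar>f t - g t\<bar> + (I / (b - a) + \<epsilon>)))"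
    using dint I0 \<open>\<epsilon> \<ge> 0\<close> 0(1) by (intro nn_integral_eq_ennreal_integral integrable_add) auto
  also have "integral {a..b} (\<lambda>t. \<bar>f t - g t\<bar> + (I / (b - a) + \<epsilon>)) = I + (b - a) * (I / (b - a) + \<epsilon>)"
    using dint 0(1) by (subst integral_add) (auto simp: I_def)
  also have "\<dots> = 2 * I + \<epsilon> * (b - a)" using 0(1) by (simp add: field_simps)
  finally show ?case by (simp add: I_def)
next
  case (Suc n)
  define c where "c = (a + b) / 2"
  let ?d = "\<lambda>t. \<bar>f t - g t\<bar>"
  have c: "a < c" "c < b" "c - a = (b - a) / 2" "b - c = (b - a) / 2"
    using Suc.prems(1) by (auto simp: c_def field_simps)
  have half: "(c - a) / 2 ^ n = (b - a) / 2 ^ Suc n" "(b - c) / 2 ^ n = (b - a) / 2 ^ Suc n"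
    unfolding c(3,4) by simp_all
  have int: "f absolutely_integrable_on {a..c}" "f absolutely_integrable_on {c..b}"
    using Suc.prems(2) c by (auto intro: absolutely_integrable_on_subinterval)
  have int': "g integrable_on {a..c}" "g integrable_on {c..b}"
    "?d integrable_on {a..c}" "?d integrable_on {c..b}"
    using Suc.prems(3,4) c by (auto intro: integrable_subinterval_real)
  have IH1: "(\<integral>\<^sup>+t\<in>{a..c}. ennreal \<bar>dyadic_mean n f a c t - f t\<bar> \<partial>lebesgue)
      \<le> ennreal (2 * integral {a..c} ?d + \<epsilon> * (c - a))"
    using c(1,2) int int' by (intro Suc.IH Suc.prems(5)) (auto simp: half simp del: power_Suc)
  have IH2: "(\<integral>\<^sup>+t\<in>{c..b}. ennreal \<bar>dyadic_mean n f c b t - f t\<bar> \<partial>lebesgue)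
      \<le> ennreal (2 * integral {c..b} ?d + \<epsilon> * (b - c))"
    using c(1,2) int int' by (intro Suc.IH Suc.prems(5)) (auto simp: half simp del: power_Suc)
  have "\<epsilon> \<ge> 0" using Suc.prems(5)[of a a] Suc.prems(1) by simp
  then have nn: "0 \<le> 2 * integral {a..c} ?d + \<epsilon> * (c - a)" "0 \<le> 2 * integral {c..b} ?d + \<epsilon> * (b - c)"
    using int' c(1,2) by (auto intro!: add_nonneg_nonneg integral_nonneg)
  have "(\<integral>\<^sup>+t\<in>{a..b}. ennreal \<bar>dyadic_mean (Suc n) f a b t - f t\<bar> \<partial>lebesgue)
    = (\<integral>\<^sup>+t\<in>{a..b}. (if t < c then ennreal \<bar>dyadic_mean n f a c t - f t\<bar>
          else ennreal \<bar>dyadic_mean n f c b t - f t\<bar>) \<partial>lebesgue)"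
    by (intro nn_integral_cong) (simp add: c_def)
  also have "\<dots> \<le> ennreal (2 * integral {a..c} ?d + \<epsilon> * (c - a))
      + ennreal (2 * integral {c..b} ?d + \<epsilon> * (b - c))"
    by (rule order_trans[OF nn_integral_if_less_le add_mono[OF IH1 IH2]]) measurable
  also have "\<dots> = ennreal (2 * (integral {a..c} ?d + integral {c..b} ?d) + \<epsilon> * (b - a))"
    using nn by (subst ennreal_plus[symmetric]) (auto simp: algebra_simps simp del: ennreal_plus)
  also have "integral {a..c} ?d + integral {c..b} ?d = integral {a..b} ?d"
    using c Suc.prems(4) by (intro Henstock_Kurzweil_Integration.integral_combine) auto
  finally show ?case .
qed

text \<open>
  A measurable function is almost everywhere a limit of continuous ones, but these need not be dominated.
  Truncating \<open>f\<close> at a high level \<open>k\<close> costs little, and truncating the continuous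
  functions at the same level makes dominated convergence applicable.
\<close>
lemma continuous_approximation_L1:
  fixes f :: "real \<Rightarrow> real"
  assumes f: "f absolutely_integrable_on {a..b}" and fm[measurable]: "f \<in> borel_measurable lebesgue" and "0 < e"
  obtains g where "continuous_on UNIV g" "(\<lambda>t. \<bar>f t - g t\<bar>) integrable_on {a..b}"
    "integral {a..b} (\<lambda>t. \<bar>f t - g t\<bar>) < e"
proof -
  define M where "M = lebesgue_on {a..b}"
  have M: "{a..b} \<in> sets lebesgue" by simp
  have fM [measurable]: "f \<in> borel_measurable M" unfolding M_def by (rule measurable_restrict_space1) simp
  have fint: "integrable M f"
    using f unfolding M_def by (simp add: integrable_restrict_space set_integrable_def)
  have const: "integrable M (\<lambda>_. c)" for c :: real
    unfolding M_def by (simp add: integrable_restrict_space)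
  define clamp where "clamp k x = max (- real k) (min (real k) x)" for k and x :: real
  have clamp_m [measurable]: "clamp k \<in> borel_measurable borel" for k
    unfolding clamp_def by measurable
  have clamp_le: "\<bar>clamp k x\<bar> \<le> real k" "\<bar>x - clamp k x\<bar> \<le> \<bar>x\<bar>" for k x
    by (auto simp: clamp_def max_def min_def)
  have clamp_cont: "continuous_on UNIV (clamp k)" for k
    unfolding clamp_def by (intro continuous_intros)
  have "(\<lambda>k. \<integral>t. \<bar>f t - clamp k (f t)\<bar> \<partial>M) \<longlonglongrightarrow> (\<integral>t. 0 \<partial>M)"
  proof (rule integral_dominated_convergence[where w = "\<lambda>t. \<bar>f t\<bar>"])
    show "AE t in M. (\<lambda>k. \<bar>f t - clamp k (f t)\<bar>) \<longlonglongrightarrow> 0"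
    proof (rule AE_I2, rule tendsto_eventually)
      fix t
      obtain N :: nat where "\<bar>f t\<bar> \<le> real N" using real_arch_simple by blast
      then show "\<forall>\<^sub>F k in sequentially. \<bar>f t - clamp k (f t)\<bar> = 0"
        by (intro eventually_sequentiallyI[of N]) (auto simp: clamp_def)
    qed
  qed (use fint clamp_le in auto)
  then have "eventually (\<lambda>k. (\<integral>t. \<bar>f t - clamp k (f t)\<bar> \<partial>M) < e/2) sequentially"
    using \<open>0 < e\<close> by (intro order_tendstoD) auto
  then obtain k where k: "(\<integral>t. \<bar>f t - clamp k (f t)\<bar> \<partial>M) < e/2"
    by (auto simp: eventually_sequentially)
  have "f measurable_on UNIV"
    using fm by (intro lebesgue_measurable_imp_measurable_on) auto
  then obtain N F where N: "negligible N" and F: "\<And>n. continuous_on UNIV (F n)"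
    and lim: "\<And>x. x \<notin> N \<Longrightarrow> (\<lambda>n::nat. F n x) \<longlonglongrightarrow> f x"
    unfolding measurable_on_def by auto
  have Fm [measurable]: "F n \<in> borel_measurable M" for n
    unfolding M_def using borel_measurable_continuous_onI[OF F[of n]]
    by (intro measurable_restrict_space1 measurable_completion) simp
  have "(\<lambda>n. \<integral>t. \<bar>clamp k (f t) - clamp k (F n t)\<bar> \<partial>M) \<longlonglongrightarrow> (\<integral>t. 0 \<partial>M)"
  proof (rule integral_dominated_convergence[where w = "\<lambda>t. 2 * real k"])
    have "AE t in lebesgue. t \<notin> N"
      using N by (intro AE_not_in) (simp add: negligible_iff_null_sets)
    then have "AE t in M. t \<notin> N" unfolding M_def by (subst AE_restrict_space_iff) auto
    then show "AE t in M. (\<lambda>n. \<bar>clamp k (f t) - clamp k (F n t)\<bar>) \<longlonglongrightarrow> 0"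
    proof (eventually_elim)
      case (elim t)
      have "(\<lambda>n. clamp k (F n t)) \<longlonglongrightarrow> clamp k (f t)"
        unfolding clamp_def by (intro tendsto_intros lim elim)
      then have "(\<lambda>n. \<bar>clamp k (f t) - clamp k (F n t)\<bar>) \<longlonglongrightarrow> \<bar>clamp k (f t) - clamp k (f t)\<bar>"
        by (intro tendsto_intros)
      then show ?case by simp
    qed
    show "AE t in M. norm \<bar>clamp k (f t) - clamp k (F n t)\<bar> \<le> 2 * real k" for n
    proof (rule AE_I2)
      fix t show "norm \<bar>clamp k (f t) - clamp k (F n t)\<bar> \<le> 2 * real k"
        using clamp_le(1)[of k "f t"] clamp_le(1)[of k "F n t"] by simp
    qed
  qed (use const in auto)
  then have "eventually (\<lambda>n. (\<integral>t. \<bar>clamp k (f t) - clamp k (F n t)\<bar> \<partial>M) < e/2) sequentially"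
    using \<open>0 < e\<close> by (intro order_tendstoD) auto
  then obtain n where n: "(\<integral>t. \<bar>clamp k (f t) - clamp k (F n t)\<bar> \<partial>M) < e/2"
    by (auto simp: eventually_sequentially)
  define g where "g t = clamp k (F n t)" for t
  have cf: "integrable M (\<lambda>t. clamp k (f t))"
    by (rule Bochner_Integration.integrable_bound[OF const[of "real k"]]) (use clamp_le in auto)
  have g: "integrable M g"
    unfolding g_def
    by (rule Bochner_Integration.integrable_bound[OF const[of "real k"]]) (use clamp_le in auto)
  have fg: "integrable M (\<lambda>t. \<bar>f t - g t\<bar>)" using fint g by auto
  have "(\<integral>t. \<bar>f t - g t\<bar> \<partial>M) \<le> (\<integral>t. \<bar>f t - clamp k (f t)\<bar> + \<bar>clamp k (f t) - g t\<bar> \<partial>M)"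
    using fint g cf by (intro integral_mono) auto
  also have "\<dots> = (\<integral>t. \<bar>f t - clamp k (f t)\<bar> \<partial>M) + (\<integral>t. \<bar>clamp k (f t) - g t\<bar> \<partial>M)"
    using fint g cf by (intro Bochner_Integration.integral_add) auto
  also have "\<dots> < e" using k n by (simp add: g_def)
  finally have "integral {a..b} (\<lambda>t. \<bar>f t - g t\<bar>) < e"
    using lebesgue_integral_eq_integral[OF fg[unfolded M_def] M] by (simp add: M_def)
  moreover have "continuous_on UNIV g"
    unfolding g_def by (intro continuous_on_compose2[OF clamp_cont F]) auto
  moreover have "(\<lambda>t. \<bar>f t - g t\<bar>) integrable_on {a..b}"
    using fg M unfolding M_def by (rule integrable_on_lebesgue_on)
  ultimately show ?thesis using that by blast
qed

text \<open>
  By approximation with uniformly continuous functions the step functions converge to \<open>f\<close> in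
  \<open>L\<^sup>1\<close>, and an \<open>L\<^sup>1\<close> convergent sequence has an almost everywhere convergent subsequence.
\<close>
lemma dyadic_mean_subseq_tendsto_AE:
  assumes "a < b" and f: "f absolutely_integrable_on {a..b}" and fm[measurable]: "f \<in> borel_measurable lebesgue"
  obtains r :: "nat \<Rightarrow> nat" where "AE t in lebesgue_on {a..b}. (\<lambda>n. dyadic_mean (r n) f a b t) \<longlonglongrightarrow> f t"
proof -
  define M where "M = lebesgue_on {a..b}"
  define u where "u n t = dyadic_mean n f a b t - f t" for n t
  have um [measurable]: "u n \<in> borel_measurable M" for n
    unfolding u_def M_def by (intro measurable_restrict_space1) measurable
  have fi: "f integrable_on {a..b}" "(\<lambda>t. \<bar>f t\<bar>) integrable_on {a..b}"
    using f by (auto simp: absolutely_integrable_on_def)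
  have nnM: "(\<integral>\<^sup>+t. ennreal \<bar>u n t\<bar> \<partial>M) = (\<integral>\<^sup>+t\<in>{a..b}. ennreal \<bar>dyadic_mean n f a b t - f t\<bar> \<partial>lebesgue)" for n
    unfolding M_def u_def by (simp add: nn_integral_restrict_space)
  have ui: "integrable M (u n)" for n
  proof (rule integrableI_bounded)
    \<comment> \<open>The comparison function \<open>g = 0\<close> already gives a finite bound.\<close>
    have "(\<integral>\<^sup>+t. ennreal \<bar>u n t\<bar> \<partial>M) \<le> ennreal (2 * integral {a..b} (\<lambda>t. \<bar>f t - 0\<bar>) + 0 * (b - a))"
      unfolding nnM using assms fi by (intro nn_integral_dyadic_mean_diff_le) auto
    then show "(\<integral>\<^sup>+t. ennreal (norm (u n t)) \<partial>M) < \<infinity>"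
      by (auto simp: le_less_trans)
  qed simp
  have "(\<lambda>n. \<integral>t. norm (u n t) \<partial>M) \<longlonglongrightarrow> 0"
  proof (rule LIMSEQ_I)
    fix e :: real assume e: "0 < e"
    obtain g where g: "continuous_on UNIV g" "(\<lambda>t. \<bar>f t - g t\<bar>) integrable_on {a..b}"
      "integral {a..b} (\<lambda>t. \<bar>f t - g t\<bar>) < e/4"
      using continuous_approximation_L1[OF f fm, of "e/4"] e by auto
    have gab: "continuous_on {a..b} g" using g(1) continuous_on_subset by blast
    then have "uniformly_continuous_on {a..b} g" by (intro compact_uniformly_continuous) auto
    then obtain d where d: "0 < d"
      "\<And>s t. s \<in> {a..b} \<Longrightarrow> t \<in> {a..b} \<Longrightarrow> \<bar>s - t\<bar> < d \<Longrightarrow> \<bar>g s - g t\<bar> < e / (4 * (b - a))"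
      using e \<open>a < b\<close> unfolding uniformly_continuous_on_def dist_real_def
      by (metis abs_minus_commute diff_gt_0_iff_gt divide_pos_pos mult_pos_pos zero_less_numeral)
    have "(\<lambda>n. (b - a) / 2 ^ n) \<longlonglongrightarrow> 0"
      by (rule LIMSEQ_divide_realpow_zero) simp
    then have "eventually (\<lambda>n. (b - a) / 2 ^ n < d) sequentially"
      using d(1) by (intro order_tendstoD) auto
    then obtain N where N: "\<And>n. n \<ge> N \<Longrightarrow> (b - a) / 2 ^ n < d"
      by (auto simp: eventually_sequentially)
    have "norm ((\<integral>t. norm (u n t) \<partial>M) - 0) < e" if "n \<ge> N" for n
    proof -
      have "ennreal (\<integral>t. \<bar>u n t\<bar> \<partial>M) = (\<integral>\<^sup>+t. ennreal \<bar>u n t\<bar> \<partial>M)"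
        using ui by (intro nn_integral_eq_integral[symmetric]) auto
      also have "\<dots> \<le> ennreal (2 * integral {a..b} (\<lambda>t. \<bar>f t - g t\<bar>) + e / (4 * (b - a)) * (b - a))"
        unfolding nnM
      proof (rule nn_integral_dyadic_mean_diff_le[OF \<open>a < b\<close> f _ g(2) fm])
        show "g integrable_on {a..b}" using gab by (rule integrable_continuous_interval)
        fix s t assume "s \<in> {a..b}" "t \<in> {a..b}" "\<bar>s - t\<bar> \<le> (b - a) / 2 ^ n"
        then show "\<bar>g s - g t\<bar> \<le> e / (4 * (b - a))"
          using N[OF that] by (intro less_imp_le d(2)) auto
      qed
      also have "e / (4 * (b - a)) * (b - a) = e/4"
        using \<open>a < b\<close> mult_divide_mult_cancel_right[of "b - a" e 4] by simp
      also have "ennreal (2 * integral {a..b} (\<lambda>t. \<bar>f t - g t\<bar>) + e/4) \<le> ennreal (3/4 * e)"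
        using g(3) by (intro ennreal_leI) linarith
      finally have "(\<integral>t. \<bar>u n t\<bar> \<partial>M) \<le> 3/4 * e" using e by (simp add: ennreal_le_iff)
      then show ?thesis using e by simp
    qed
    then show "\<exists>N. \<forall>n\<ge>N. norm ((\<integral>t. norm (u n t) \<partial>M) - 0) < e" by blast
  qed
  from tendsto_L1_AE_subseq[OF ui this]
  obtain r :: "nat \<Rightarrow> nat" where "AE t in M. (\<lambda>n. u (r n) t) \<longlonglongrightarrow> 0" by blast
  then have "AE t in M. (\<lambda>n. dyadic_mean (r n) f a b t) \<longlonglongrightarrow> f t"
    by eventually_elim (simp add: u_def LIM_zero_iff)
  then show ?thesis using that unfolding M_def by blast
qed

section \<open>The reverse Hoelder inequality\<close>

text \<open>
  The bound for \<^term>\<open>dyadic_mean n f a b\<close> does not depend on \<open>n\<close>, so it survives the passage to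
  \<open>f\<close> by Fatou's lemma. Strict positivity of \<open>f\<close> makes the power continuous at its values.
\<close>
lemma reverse_holder_of_positive:
  assumes \<alpha>: "0 < \<alpha>" "24 * \<alpha> * Q\<^sup>2 \<le> 1" "Q \<ge> 1" and "a < b"
    and fm[measurable]: "f \<in> borel_measurable lebesgue" and pos: "\<And>t. t \<in> {a..b} \<Longrightarrow> 0 < f t"
    and int: "f integrable_on {a..b}" "(\<lambda>t. inverse (f t)) integrable_on {a..b}"
    and le: "\<And>c d. a \<le> c \<Longrightarrow> c < d \<Longrightarrow> d \<le> b \<Longrightarrow> mean f c d * mean (\<lambda>t. inverse (f t)) c d \<le> Q"
  shows "(\<integral>\<^sup>+t\<in>{a..b}. ennreal (f t powr (1 + \<alpha>)) \<partial>lebesgue)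
    \<le> ennreal (2 * (b - a) * mean f a b powr (1 + \<alpha>))"
proof -
  define M where "M = lebesgue_on {a..b}"
  have "f absolutely_integrable_on {a..b}"
    using int(1) pos by (intro nonnegative_absolutely_integrable_1) (auto simp: less_imp_le)
  from dyadic_mean_subseq_tendsto_AE[OF \<open>a < b\<close> this fm]
  obtain r :: "nat \<Rightarrow> nat" where r: "AE t in M. (\<lambda>n. dyadic_mean (r n) f a b t) \<longlonglongrightarrow> f t"
    unfolding M_def by blast
  let ?h = "\<lambda>n t. ennreal (dyadic_mean n f a b t powr (1 + \<alpha>))"
  have hm: "?h n \<in> borel_measurable M" for n
    unfolding M_def by (intro measurable_restrict_space1) measurable
  have bound: "(\<integral>\<^sup>+t. ?h n t \<partial>M) \<le> ennreal (2 * (b - a) * mean f a b powr (1 + \<alpha>))" for n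
  proof -
    have "(\<integral>\<^sup>+t. ?h n t \<partial>M) = (\<integral>\<^sup>+t\<in>{a..b}. ?h n t \<partial>lebesgue)"
      unfolding M_def by (simp add: nn_integral_restrict_space)
    also have "\<dots> \<le> ennreal ((b - a) * bellman \<alpha> (mean f a b) (mean (\<lambda>t. inverse (f t)) a b))"
      using assms by (intro nn_integral_dyadic_mean_le_bellman) auto
    also have "\<dots> \<le> ennreal ((b - a) * (2 * mean f a b powr (1 + \<alpha>)))"
      using \<open>a < b\<close> by (intro ennreal_leI mult_left_mono) (auto simp: bellman_def)
    finally show ?thesis by (simp only: mult.assoc mult.left_commute)
  qed
  have "AE t in M. ennreal (f t powr (1 + \<alpha>)) = liminf (\<lambda>n. ?h (r n) t)"
    using r AE_space
  proof eventually_elim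
    case (elim t)
    then have "f t \<noteq> 0" using pos[of t] by (auto simp: M_def space_restrict_space)
    then have "(\<lambda>n. ?h (r n) t) \<longlonglongrightarrow> ennreal (f t powr (1 + \<alpha>))"
      using elim by (intro tendsto_ennrealI tendsto_powr) auto
    then show ?case by (intro lim_imp_Liminf[symmetric]) auto
  qed
  then have "(\<integral>\<^sup>+t. ennreal (f t powr (1 + \<alpha>)) \<partial>M) = (\<integral>\<^sup>+t. liminf (\<lambda>n. ?h (r n) t) \<partial>M)"
    by (rule nn_integral_cong_AE)
  also have "\<dots> \<le> liminf (\<lambda>n. \<integral>\<^sup>+t. ?h (r n) t \<partial>M)"
    by (rule nn_integral_liminf) (rule hm)
  also have "\<dots> \<le> ennreal (2 * (b - a) * mean f a b powr (1 + \<alpha>))"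
    using bound by (intro Liminf_le) auto
  finally show ?thesis unfolding M_def by (simp add: nn_integral_restrict_space)
qed

section \<open>Weights of class A2\<close>

lemma integrable_on_of_nn_integral_finite:
  fixes f :: "real \<Rightarrow> real"
  assumes [measurable]: "f \<in> borel_measurable lebesgue" "S \<in> sets lebesgue"
    and nonneg: "\<And>t. t \<in> S \<Longrightarrow> 0 \<le> f t" and fin: "(\<integral>\<^sup>+t\<in>S. ennreal (f t) \<partial>lebesgue) < \<infinity>"
  shows "f integrable_on S"
proof -
  let ?F = "\<lambda>t. if t \<in> S then f t else 0"
  have "(\<integral>\<^sup>+t. ennreal (?F t) \<partial>lebesgue) = (\<integral>\<^sup>+t\<in>S. ennreal (f t) \<partial>lebesgue)"
    by (intro nn_integral_cong) (auto simp: indicator_def)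
  moreover have "?F \<in> borel_measurable lebesgue" by measurable
  ultimately have "(?F has_integral enn2real (\<integral>\<^sup>+t\<in>S. ennreal (f t) \<partial>lebesgue)) UNIV"
    using nonneg fin by (subst has_integral_iff_nn_integral_lebesgue) (auto simp: less_top)
  then have "?F integrable_on UNIV" by blast
  then show ?thesis by (simp only: integrable_restrict_UNIV)
qed

lemma avg_eq_mean:
  assumes "c < d" "f integrable_on {c..d}" "\<And>t. t \<in> {c..d} \<Longrightarrow> 0 \<le> f t"
    and ae: "AE t in lebesgue. t \<in> {c..d} \<longrightarrow> \<phi> t = ennreal (f t)"
  shows "avg {c..d} \<phi> = ennreal (mean f c d)"
proof -
  have "(\<integral>\<^sup>+t\<in>{c..d}. \<phi> t \<partial>lebesgue) = (\<integral>\<^sup>+t\<in>{c..d}. ennreal (f t) \<partial>lebesgue)"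
    using ae by (intro nn_integral_cong_AE) (auto simp: indicator_def)
  also have "\<dots> = ennreal (integral {c..d} f)"
    using assms by (intro nn_integral_eq_ennreal_integral)
  finally show ?thesis
    using assms divide_ennreal[OF integral_nonneg[OF assms(2,3)], of "d - c"]
    by (simp add: avg_def mean_def)
qed

lemma A2_reverse_holder:
  assumes \<alpha>: "0 < \<alpha>" "24 * \<alpha> * Q\<^sup>2 \<le> 1" and Q: "Q \<ge> 1"
    and w: "w \<in> A2" "A2_char w \<le> ennreal Q"
  shows "avg {0..1} (\<lambda>t. ennreal (w t powr (1 + \<alpha>)))
    \<le> ennreal (2 * enn2real (avg {0..1} (\<lambda>t. ennreal (w t))) powr (1 + \<alpha>))"
proof -
  \<comment> \<open>The reciprocal of \<open>w\<close> is integrable, so \<open>w\<close> vanishes only on a null set. Changing it to \<open>1\<close>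
    there and outside \<open>[0,1]\<close> gives a globally measurable, strictly positive \<open>f\<close> with the same averages.\<close>
  define v where "v t = (if t \<in> {0..1} then w t else 0)" for t
  define f where "f t = (if 0 < v t then v t else 1)" for t
  have "w \<in> borel_measurable (lebesgue_on {0..1})" and w0: "\<And>t. t \<in> {0..1} \<Longrightarrow> 0 \<le> w t"
    and wfin: "(\<integral>\<^sup>+t\<in>{0..1}. ennreal (w t) \<partial>lebesgue) < \<infinity>"
    and rfin: "(\<integral>\<^sup>+t\<in>{0..1}. recip w t \<partial>lebesgue) < \<infinity>"
    using w(1) by (auto simp: A2_def weight_def)
  then have vm [measurable]: "v \<in> borel_measurable lebesgue"
    unfolding v_def[abs_def] by (intro borel_measurable_if_I) auto
  have fm [measurable]: "f \<in> borel_measurable lebesgue" unfolding f_def[abs_def] by measurable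
  have fpos: "0 < f t" for t by (simp add: f_def)
  have S [measurable]: "{0..1::real} \<in> sets lebesgue" by simp
  have rv: "recip w t * indicator {0..1} t = inverse (ennreal (v t)) * indicator {0..1} t" for t
    by (simp add: recip_def v_def indicator_def)
  have "AE t in lebesgue. recip w t * indicator {0..1} t \<noteq> \<infinity>"
  proof (rule nn_integral_noteq_infinite)
    show "(\<lambda>t. recip w t * indicator {0..1} t) \<in> borel_measurable lebesgue"
      unfolding rv by measurable
  qed (use rfin in auto)
  then have ae: "AE t in lebesgue. t \<in> {0..1} \<longrightarrow> w t = f t"
  proof eventually_elim
    case (elim t)
    show ?case
    proof
      assume t: "t \<in> {0..1}"
      with elim have "w t \<noteq> 0" by (auto simp: recip_def)
      then show "w t = f t" using w0[OF t] t by (simp add: f_def v_def)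
    qed
  qed
  have aef: "AE t in lebesgue. t \<in> {0..1} \<longrightarrow> ennreal (w t) = ennreal (f t)"
    using ae by eventually_elim auto
  have aer: "AE t in lebesgue. t \<in> {0..1} \<longrightarrow> recip w t = ennreal (inverse (f t))"
    using ae by eventually_elim (auto simp: recip_def inverse_ennreal[OF fpos])
  have fint: "f integrable_on {0..1}"
  proof (rule integrable_on_of_nn_integral_finite)
    have "(\<integral>\<^sup>+t\<in>{0..1}. ennreal (f t) \<partial>lebesgue) = (\<integral>\<^sup>+t\<in>{0..1}. ennreal (w t) \<partial>lebesgue)"
      using aef by (intro nn_integral_cong_AE) (auto simp: indicator_def)
    then show "(\<integral>\<^sup>+t\<in>{0..1}. ennreal (f t) \<partial>lebesgue) < \<infinity>" using wfin by simp
  qed (use fpos in \<open>auto simp: less_imp_le\<close>)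
  have gint: "(\<lambda>t. inverse (f t)) integrable_on {0..1}"
  proof (rule integrable_on_of_nn_integral_finite)
    have "(\<integral>\<^sup>+t\<in>{0..1}. ennreal (inverse (f t)) \<partial>lebesgue) = (\<integral>\<^sup>+t\<in>{0..1}. recip w t \<partial>lebesgue)"
      using aer by (intro nn_integral_cong_AE) (auto simp: indicator_def)
    then show "(\<integral>\<^sup>+t\<in>{0..1}. ennreal (inverse (f t)) \<partial>lebesgue) < \<infinity>" using rfin by simp
  qed (use fpos in \<open>auto simp: less_imp_le\<close>)
  have avg_w: "avg {c..d} (\<lambda>t. ennreal (w t)) = ennreal (mean f c d)"
    and avg_r: "avg {c..d} (recip w) = ennreal (mean (\<lambda>t. inverse (f t)) c d)"
    if "0 \<le> c" "c < d" "d \<le> 1" for c d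
    using that fpos fint gint aef aer
    by (intro avg_eq_mean; auto simp: less_imp_le intro: integrable_subinterval_real)+
  have prod: "mean f c d * mean (\<lambda>t. inverse (f t)) c d \<le> Q" if "0 \<le> c" "c < d" "d \<le> 1" for c d
  proof -
    have m: "0 \<le> mean f c d"
      unfolding mean_def using that fpos fint
      by (intro divide_nonneg_nonneg integral_nonneg integrable_subinterval_real[OF fint])
        (auto simp: less_imp_le)
    have "ennreal (mean f c d * mean (\<lambda>t. inverse (f t)) c d)
        = avg {c..d} (\<lambda>t. ennreal (w t)) * avg {c..d} (recip w)"
      unfolding avg_w[OF that] avg_r[OF that] using m by (simp add: ennreal_mult')
    also have "\<dots> \<le> A2_char w"
      unfolding A2_char_def using that by (intro SUP_upper) (auto simp: is_interval_cc)
    also have "\<dots> \<le> ennreal Q" by (rule w(2))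
    finally show ?thesis using Q by (simp add: ennreal_le_iff)
  qed
  have "(\<integral>\<^sup>+t\<in>{0..1}. ennreal (w t powr (1 + \<alpha>)) \<partial>lebesgue)
      = (\<integral>\<^sup>+t\<in>{0..1}. ennreal (f t powr (1 + \<alpha>)) \<partial>lebesgue)"
    using ae by (intro nn_integral_cong_AE) (auto simp: indicator_def)
  also have "\<dots> \<le> ennreal (2 * (1 - 0) * mean f 0 1 powr (1 + \<alpha>))"
    using fpos fint gint prod by (intro reverse_holder_of_positive[OF \<alpha> Q]) auto
  also have "mean f 0 1 = enn2real (avg {0..1} (\<lambda>t. ennreal (w t)))"
  proof -
    have "0 \<le> mean f 0 1"
      unfolding mean_def using fpos fint by (auto simp: less_imp_le intro!: integral_nonneg)
    then show ?thesis using avg_w[of 0 1] by simp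
  qed
  finally show "avg {0..1} (\<lambda>t. ennreal (w t powr (1 + \<alpha>)))
      \<le> ennreal (2 * enn2real (avg {0..1} (\<lambda>t. ennreal (w t))) powr (1 + \<alpha>))"
    by (simp add: avg_def divide_ennreal_def)
qed

theorem theorem8p1:
  fixes Q :: real
  assumes "Q \<ge> 1"
  shows "\<exists>\<alpha>0::real. \<alpha>0 > 0 \<and>
    (\<forall>\<alpha>::real. 0 < \<alpha> \<and> \<alpha> < \<alpha>0 \<longrightarrow>
      (\<exists>C::real. \<forall>w::real \<Rightarrow> real.
        w \<in> A2 \<and> A2_char w = ennreal Q \<longrightarrow>
          avg {0..1} (\<lambda>t. ennreal (w t powr (1 + \<alpha>)))
            \<le> ennreal (C * enn2real (avg {0..1} (\<lambda>t. ennreal (w t))) powr (1 + \<alpha>))))"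
proof (rule exI[of _ "1 / (24 * Q\<^sup>2)"], intro conjI allI impI)
  show "0 < 1 / (24 * Q\<^sup>2)" using assms by simp
  fix \<alpha> :: real
  assume "0 < \<alpha> \<and> \<alpha> < 1 / (24 * Q\<^sup>2)"
  then have "0 < \<alpha>" "24 * \<alpha> * Q\<^sup>2 \<le> 1"
    using assms by (auto simp: field_simps)
  with assms show "\<exists>C::real. \<forall>w::real \<Rightarrow> real.
        w \<in> A2 \<and> A2_char w = ennreal Q \<longrightarrow>
          avg {0..1} (\<lambda>t. ennreal (w t powr (1 + \<alpha>)))
            \<le> ennreal (C * enn2real (avg {0..1} (\<lambda>t. ennreal (w t))) powr (1 + \<alpha>))"
    by (intro exI[of _ 2] allI impI A2_reverse_holder) auto
qed

end
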